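(* Let $d\ge 1$ be an integer, let $X_1,X_2,\ldots$ be independent random points uniformly distributed in $Q_d=[0,1]^d$, and let $p_n$ be the probability that a chain record occurs at index $n$ (that is, $p_n=\mathbb{P}(n=T_k\text{ for some }k\ge 1)$). Put $g(\lambda)=(\lambda+1)^{-d}$. Then for every $n\ge 1$ $$p_n=\sum_{k=0}^{n-1}\binom{n-1}{k}(-1)^k\prod_{j=0}^{k-1}\bigl(1-g(j+1)\bigr)$$ (where the empty product equals $1$), and $$p_n\sim\frac{1}{d\,n}\qquad\text{as } n\to\infty.$$
   Context: For $x,y\in\mathbb{R}^d$ write $x\prec y$ iff $x\neq y$ and $x^{(i)}\le y^{(i)}$ for all $i=1,\ldots,d$. The chain records of the sequence $X_1,X_2,\ldots$ are defined recursively: $T_1=1$, $R_1=X_1$, and for $k>1$, $T_k=\min\{n>T_{k-1}: X_n\prec R_{k-1}\}$, $R_k=X_{T_k}$. (Almost surely all $T_k$ are finite.) A chain record occurs at index $n$ if $n=T_k$ for some $k$. *)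

theory Defs
  imports "HOL-Probability.Probability" "HOL-Library.Landau_Symbols" "HOL-Library.Extended_Nat"
begin

definition prec :: "real ^ 'd \<Rightarrow> real ^ 'd \<Rightarrow> bool" (infix "\<prec>" 50)
  where "x \<prec> y \<longleftrightarrow> x \<noteq> y \<and> (\<forall>i. x $ i \<le> y $ i)"

text \<open>
  Sequences are indexed from 1, so the entry \<open>x 0\<close> is never looked at. The record number is
  shifted: \<open>chain_time x k\<close> is the time \<open>T\<close> of the \<open>(k + 1)\<close>-st chain record, and the value
  of that record is \<open>x (the_enat (chain_time x k))\<close>. If there is no further record, the
  infimum is taken over the empty set and this time and all later ones are \<open>\<infinity>\<close>.
\<close>

primrec chain_time :: "(nat \<Rightarrow> real ^ 'd) \<Rightarrow> nat \<Rightarrow> enat" where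
  "chain_time x 0 = 1"
| "chain_time x (Suc k) =
     Inf {enat n | n. chain_time x k < enat n \<and> x n \<prec> x (the_enat (chain_time x k))}"

definition chain_record_at :: "(nat \<Rightarrow> real ^ 'd) \<Rightarrow> nat \<Rightarrow> bool"
  where "chain_record_at x n \<longleftrightarrow> (\<exists>k. chain_time x k = enat n)"

definition chain_record_prob :: "'a measure \<Rightarrow> (nat \<Rightarrow> 'a \<Rightarrow> real ^ 'd) \<Rightarrow> nat \<Rightarrow> real"
  where "chain_record_prob M X n =
    measure M {\<omega> \<in> space M. chain_record_at (\<lambda>m. X m \<omega>) n}"

definition g :: "nat \<Rightarrow> real \<Rightarrow> real"
  where "g d l = 1 / (l + 1) ^ d"

end

(*
  Let Y_n be the volume of the box below the current chain record R after n points. A new uniform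
  point falls into this box with probability Y_n and is then uniform in it, so the moments
  m_n(s) = E(Y_n^s) satisfy m_{n+1}(s) = m_n(s) - (1 - g(s)) m_n(s+1) with m_0 = 1. Unfolding the
  recursion gives the alternating sum, since p_{n+1} = m_n(1).

  For the asymptotics write a_k for the product in the sum and
    u_i(n) = sum_k binom(n,k) (-1)^k a_k / (k+2)^i   (0 <= i <= d).
  Then (n+2) u_{i+1}(n) = n u_{i+1}(n-1) + u_i(n), and a_k / (k+2)^d = a_k - a_{k+1} gives
  u_d(n) = u_0(n+1). After scaling (h_i = (n+1) u_i for i < d and h_d = (n+2) u_d) each h_{i+1}(n)
  is a convex combination of h_{i+1}(n-1) and h_i(n) with weight of order 1/n on the latter, and
  h_0(n+1) = h_d(n). This cyclic averaging conserves h_1 + ... + h_d = 1 and decreases the sum of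
  squares, and since the harmonic series diverges all h_i converge to 1/d. Finally
  h_d(n) = (n+2) p_{n+2}.
*)
theory Submission
  imports Defs
begin

section \<open>Chain records and the running record\<close>

text \<open>Time is shifted here: \<^term>\<open>current_record x n\<close> is the last chain record among
  \<open>x 1, \<dots>, x (n + 1)\<close>. The relation is written \<^const>\<open>prec\<close> because its infix symbol also
  denotes a relation on sets from the library, which makes it ambiguous.\<close>

primrec current_record :: "(nat \<Rightarrow> real ^ 'd) \<Rightarrow> nat \<Rightarrow> real ^ 'd" where
  "current_record x 0 = x 1"
| "current_record x (Suc n) =
     (if prec (x (Suc (Suc n))) (current_record x n) then x (Suc (Suc n)) else current_record x n)"

lemma chain_time_le_Suc: "chain_time x k \<le> chain_time x (Suc k)"
  by (auto simp: le_Inf_iff less_imp_le)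

lemma chain_time_mono: "k \<le> l \<Longrightarrow> chain_time x k \<le> chain_time x l"
  by (rule lift_Suc_mono_le[of "chain_time x"]) (rule chain_time_le_Suc)

lemma chain_time_Suc_eq:
  assumes "chain_time x k = enat t" "t < n" "prec (x n) (x t)"
    and "\<And>m. t < m \<Longrightarrow> m < n \<Longrightarrow> \<not> prec (x m) (x t)"
  shows "chain_time x (Suc k) = enat n"
proof -
  have "Inf {enat m | m. t < m \<and> prec (x m) (x t)} = enat n"
  proof (rule Inf_eqI)
    fix i assume "i \<in> {enat m | m. t < m \<and> prec (x m) (x t)}"
    then show "enat n \<le> i"
      using assms(4) by (auto simp: not_less[symmetric])
  next
    fix y assume "\<And>i. i \<in> {enat m | m. t < m \<and> prec (x m) (x t)} \<Longrightarrow> y \<le> i"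
    then show "y \<le> enat n" using assms(2,3) by blast
  qed
  then show ?thesis using assms(1) by simp
qed

text \<open>Only a lower bound, so that it also covers the case where no further record comes and
  the infimum is \<infinity>.\<close>

lemma chain_time_Suc_ge:
  assumes "chain_time x k = enat t"
    and "\<And>m. t < m \<Longrightarrow> m < n \<Longrightarrow> \<not> prec (x m) (x t)"
  shows "enat n \<le> chain_time x (Suc k)"
proof -
  have "enat n \<le> Inf {enat m | m. t < m \<and> prec (x m) (x t)}"
    using assms(2) by (intro Inf_greatest) (auto simp: not_less[symmetric])
  then show ?thesis using assms(1) by simp
qed

text \<open>The last conjunct is the invariant that drives the induction: as no point after time
  \<open>t\<close> has beaten \<open>x t\<close> so far, the next point that does so realises the
  infimum defining the next chain time.\<close>

lemma current_record_is_chain_record: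
  "\<exists>k t. chain_time x k = enat t \<and> t \<le> Suc n \<and> current_record x n = x t \<and>
     (\<forall>m. t < m \<longrightarrow> m \<le> Suc n \<longrightarrow> \<not> prec (x m) (x t))"
proof (induction n)
  case 0
  have "chain_time x 0 = enat 1" by (simp add: one_enat_def)
  then show ?case by (intro exI[of _ 0] exI[of _ 1]) auto
next
  case (Suc n)
  then obtain k t where kt: "chain_time x k = enat t" "t \<le> Suc n" "current_record x n = x t"
    "\<And>m. t < m \<Longrightarrow> m \<le> Suc n \<Longrightarrow> \<not> prec (x m) (x t)" by blast
  show ?case
  proof (cases "prec (x (Suc (Suc n))) (x t)")
    case True
    then have "chain_time x (Suc k) = enat (Suc (Suc n))"
      using kt by (intro chain_time_Suc_eq) auto
    then show ?thesis using True kt(3)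
      by (intro exI[of _ "Suc k"] exI[of _ "Suc (Suc n)"]) auto
  next
    case False
    then show ?thesis using kt
      by (intro exI[of _ k] exI[of _ t]) (auto simp: le_Suc_eq)
  qed
qed

lemma chain_record_at_1: "chain_record_at x 1"
  unfolding chain_record_at_def by (intro exI[of _ 0]) (simp add: one_enat_def)

text \<open>Reduces the event to a comparison of the new point with a function of the earlier
  points, which is the form in which independence applies.\<close>

lemma chain_record_at_iff:
  "chain_record_at x (Suc (Suc n)) \<longleftrightarrow> prec (x (Suc (Suc n))) (current_record x n)"
proof -
  obtain k t where kt: "chain_time x k = enat t" "t \<le> Suc n" "current_record x n = x t"
    "\<And>m. t < m \<Longrightarrow> m \<le> Suc n \<Longrightarrow> \<not> prec (x m) (x t)"
    using current_record_is_chain_record[of x n] by blast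
  show ?thesis
  proof
    assume "prec (x (Suc (Suc n))) (current_record x n)"
    then have "chain_time x (Suc k) = enat (Suc (Suc n))"
      using kt by (intro chain_time_Suc_eq) auto
    then show "chain_record_at x (Suc (Suc n))" unfolding chain_record_at_def by blast
  next
    assume "chain_record_at x (Suc (Suc n))"
    then obtain l where l: "chain_time x l = enat (Suc (Suc n))"
      unfolding chain_record_at_def by blast
    show "prec (x (Suc (Suc n))) (current_record x n)"
    proof (rule ccontr)
      assume "\<not> ?thesis"
      then have "enat (Suc (Suc (Suc n))) \<le> chain_time x (Suc k)"
        using kt by (intro chain_time_Suc_ge[of x k t]) (auto simp: less_Suc_eq_le le_Suc_eq)
      \<comment> \<open>Monotonicity then puts chain time \<open>l\<close> either at most at
        \<open>n + 1\<close> or at least at \<open>n + 3\<close>, never at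
        \<open>n + 2\<close>.\<close>
      moreover have "l \<le> k \<or> Suc k \<le> l" by linarith
      ultimately show False
        using chain_time_mono[of l k x] chain_time_mono[of "Suc k" l x] l kt(1,2)
        by (auto simp del: chain_time.simps dest: order_trans)
    qed
  qed
qed

section \<open>Asymptotics of the alternating sum\<close>

text \<open>Summing the steps shifts the index of \<open>x'\<close> by one and leaves the boundary
  term \<open>x d - x' d\<close>; the smaller weight \<open>N\<close> at the last index cancels
  exactly this term. It is applied to the values, with \<open>\<delta> = 0\<close>, and to their
  squares, where \<open>\<delta>\<close> is the loss.\<close>

lemma sum_cyclic_step:
  fixes x x' \<delta> :: "nat \<Rightarrow> real"
  assumes "d \<ge> 1" "x' 0 = x d"
    and step: "\<And>i. i < d \<Longrightarrow> c i * x' (Suc i) = (c i - 1) * x (Suc i) + x' i - \<delta> i"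
    and c: "\<And>i. c i = (if Suc i = d then N else N + 1)"
  shows "N * ((\<Sum>i<d. x' (Suc i)) - (\<Sum>i<d. x (Suc i))) = - (\<Sum>i<d. \<delta> i)"
proof -
  obtain e where d: "d = Suc e" using assms(1) by (cases d) auto
  have weights: "(\<Sum>i<d. c i * y (Suc i)) = (N + 1) * (\<Sum>i<d. y (Suc i)) - y d" for y :: "nat \<Rightarrow> real"
    by (simp add: d c sum_distrib_left algebra_simps)
  have "(\<Sum>i<d. c i * x' (Suc i)) =
      (\<Sum>i<d. c i * x (Suc i) - x (Suc i) + x' i - \<delta> i)"
    by (intro sum.cong refl) (simp add: step left_diff_distrib)
  then have "(\<Sum>i<d. c i * x' (Suc i)) =
      (\<Sum>i<d. c i * x (Suc i)) - (\<Sum>i<d. x (Suc i)) + (\<Sum>i<d. x' i) - (\<Sum>i<d. \<delta> i)"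
    by (simp only: sum.distrib sum_subtractf)
  moreover have "(\<Sum>i<d. x' i) = (\<Sum>i<d. x' (Suc i)) + x' 0 - x' d"
    using sum.lessThan_Suc[of x' d] sum.lessThan_Suc_shift[of x' d] by simp
  ultimately show ?thesis
    using assms(2) weights[of x] weights[of x'] by (simp add: algebra_simps)
qed

text \<open>A Lyapunov argument: \<open>F\<close>, the squared distance to the constant vector
  \<open>1 / d\<close>, drops by exactly \<open>D n / (n + 2)\<close> in each step.\<close>

lemma cyclic_averaging_tendsto:
  fixes h :: "nat \<Rightarrow> nat \<Rightarrow> real"
  defines "c \<equiv> \<lambda>d n i. if Suc i = d then real n + 2 else real n + 2 + 1"
  assumes d: "d \<ge> 1"
    and wrap: "\<And>n. h 0 (Suc n) = h d n"
    and step: "\<And>n i. i < d \<Longrightarrow>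
      c d n i * h (Suc i) (Suc n) = (c d n i - 1) * h (Suc i) n + h i (Suc n)"
    and init: "(\<Sum>i<d. h (Suc i) 0) = 1"
  shows "h d \<longlonglongrightarrow> 1 / real d"
proof -
  define \<delta> where "\<delta> n i = h i (Suc n) - h (Suc i) n" for n i
  define D where "D n = (\<Sum>i<d. (c d n i - 1) / c d n i * (\<delta> n i)\<^sup>2)" for n
  define F where "F n = (\<Sum>i<d. (h (Suc i) n - 1 / real d)\<^sup>2)" for n
  have c2: "c d n i \<ge> 2" for n i by (simp add: c_def)
  have total: "(\<Sum>i<d. h (Suc i) n) = 1" for n
  proof (induction n)
    case (Suc n)
    have "(real n + 2) * ((\<Sum>i<d. h (Suc i) (Suc n)) - (\<Sum>i<d. h (Suc i) n)) = - (\<Sum>i<d. 0)"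
      by (rule sum_cyclic_step[where c = "c d n" and x' = "\<lambda>i. h i (Suc n)" and x = "\<lambda>i. h i n"])
        (use d wrap step in \<open>auto simp: c_def\<close>)
    then show ?case using Suc by simp
  qed (use init in simp)
  have F_eq: "F n = (\<Sum>i<d. (h (Suc i) n)\<^sup>2) - 1 / real d" for n
  proof -
    have "F n = (\<Sum>i<d. (h (Suc i) n)\<^sup>2 - 2 / real d * h (Suc i) n + 1 / (real d)\<^sup>2)"
      unfolding F_def by (intro sum.cong refl) (simp add: power2_eq_square algebra_simps)
    also have "\<dots> = (\<Sum>i<d. (h (Suc i) n)\<^sup>2) - 2 / real d + real d * (1 / (real d)\<^sup>2)"
      by (simp only: sum.distrib sum_subtractf sum_distrib_left[symmetric] total) simp
    finally show ?thesis using d by (simp add: power2_eq_square)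
  qed
  \<comment> \<open>The variance identity for the mean \<open>z\<close> of \<open>x\<close> and
    \<open>y\<close> with weights \<open>(c - 1) / c\<close> and \<open>1 / c\<close>, multiplied by
    \<open>c\<close>.\<close>
  have sq_step: "c * z\<^sup>2 = (c - 1) * x\<^sup>2 + y\<^sup>2 - (c - 1) / c * (y - x)\<^sup>2"
    if "c * z = (c - 1) * x + y" "c \<ge> 2" for c x y z :: real
  proof -
    have "c * (c * z\<^sup>2) = ((c - 1) * x + y)\<^sup>2" using that(1)[symmetric]
      by (simp add: power2_eq_square)
    also have "\<dots> = c * ((c - 1) * x\<^sup>2 + y\<^sup>2) - (c - 1) * (y - x)\<^sup>2"
      by (simp add: power2_eq_square algebra_simps)
    also have "\<dots> = c * ((c - 1) * x\<^sup>2 + y\<^sup>2 - (c - 1) / c * (y - x)\<^sup>2)"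
      using that(2) by (simp add: right_diff_distrib)
    finally show ?thesis using that(2) by simp
  qed
  have F_Suc: "F (Suc n) = F n - D n / (real n + 2)" for n
  proof -
    have "(real n + 2) * ((\<Sum>i<d. (h (Suc i) (Suc n))\<^sup>2) - (\<Sum>i<d. (h (Suc i) n)\<^sup>2)) = - D n"
      unfolding D_def
    proof (rule sum_cyclic_step[OF d])
      show "(h 0 (Suc n))\<^sup>2 = (h d n)\<^sup>2" by (simp add: wrap)
      show "c d n i * (h (Suc i) (Suc n))\<^sup>2 = (c d n i - 1) * (h (Suc i) n)\<^sup>2
        + (h i (Suc n))\<^sup>2 - (c d n i - 1) / c d n i * (\<delta> n i)\<^sup>2" if "i < d" for i
        unfolding \<delta>_def by (rule sq_step[OF step[OF that] c2])
      show "c d n i = (if Suc i = d then real n + 2 else real n + 2 + 1)" for i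
        by (simp add: c_def)
    qed
    then have "(real n + 2) * (F (Suc n) - F n) = - D n" by (simp add: F_eq)
    then show ?thesis by (simp add: field_simps)
  qed
  have D_ge: "(\<Sum>i<d. (\<delta> n i)\<^sup>2) / 2 \<le> D n" for n
    unfolding D_def sum_divide_distrib
  proof (intro sum_mono)
    fix i
    have "1 / 2 * (\<delta> n i)\<^sup>2 \<le> (c d n i - 1) / c d n i * (\<delta> n i)\<^sup>2"
      using c2[of n i] by (intro mult_right_mono) (auto simp: field_simps)
    then show "(\<delta> n i)\<^sup>2 / 2 \<le> (c d n i - 1) / c d n i * (\<delta> n i)\<^sup>2" by simp
  qed
  then have D0: "D n \<ge> 0" for n
    by (meson D_ge divide_nonneg_pos order_trans sum_nonneg zero_le_power2 zero_less_numeral)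
  have F0: "F n \<ge> 0" for n unfolding F_def by (intro sum_nonneg) auto
  have decF: "decseq F"
    by (rule decseq_SucI) (use D0 in \<open>simp add: F_Suc\<close>)
  \<comment> \<open>Otherwise \<open>F\<close> would lose at least \<open>\<eta> / (n + 2)\<close>
    at every step, and \<open>F \<ge> 0\<close> would bound the harmonic sums.\<close>
  have small_D: "\<exists>n. D n < \<eta>" if "\<eta> > 0" for \<eta>
  proof (rule ccontr)
    assume "\<not> ?thesis"
    then have *: "D n \<ge> \<eta>" for n by (simp add: not_less)
    have "F n \<le> F 0 - \<eta> * (\<Sum>k<n. 1 / real (k + 2))" for n
    proof (induction n)
      case (Suc n)
      have "\<eta> / (real n + 2) \<le> D n / (real n + 2)" using * by (intro divide_right_mono) auto
      then show ?case using Suc by (simp add: F_Suc algebra_simps)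
    qed simp
    then have "(\<Sum>k<n. 1 / real (k + 2)) \<le> F 0 / \<eta>" for n
      using F0[of n] that by (smt (verit) mult.commute pos_le_divide_eq)
    then have "summable (\<lambda>k. 1 / real (k + 2))"
      by (intro bounded_imp_summable[where B = "F 0 / \<eta>"])
        (simp_all only: lessThan_Suc_atMost[symmetric], simp)
    then have "summable (\<lambda>k. inverse (real k))"
      using summable_iff_shift[of "\<lambda>k. inverse (real k)" 2] by (simp add: inverse_eq_divide)
    then show False using not_summable_harmonic[where 'a = real] by simp
  qed
  \<comment> \<open>At a time where the dissipation \<open>D\<close> is small, neighbouring coordinates are close, so all are
    close to their mean \<open>1 / d\<close>; since \<open>F\<close> is monotone, one such time is enough.\<close>
  have F_small: "\<exists>n. F n \<le> 4 * real d ^ 3 * e\<^sup>2" if e: "e > 0" for e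
  proof -
    obtain n where "D n < e\<^sup>2 / 2" using small_D[of "e\<^sup>2 / 2"] e by auto
    then have "(\<Sum>i<d. (\<delta> n i)\<^sup>2) \<le> e\<^sup>2" using D_ge[of n] by linarith
    then have "(\<delta> n i)\<^sup>2 \<le> e\<^sup>2" if "i < d" for i
      using member_le_sum[of i "{..<d}" "\<lambda>i. (\<delta> n i)\<^sup>2"] that by auto
    then have \<delta>: "\<bar>\<delta> n i\<bar> \<le> e" if "i < d" for i
      using that e by (simp add: abs_le_square_iff[symmetric])
    \<comment> \<open>\<open>\<delta> n i\<close> compares values at different times. One averaging
      step moves \<open>h (Suc i)\<close> towards \<open>h i (Suc n)\<close>, so the gap at equal
      times is smaller by the factor \<open>1 - 1 / c d n i\<close>.\<close>
    have diff: "\<bar>h i (Suc n) - h (Suc i) (Suc n)\<bar> \<le> e" if "i < d" for i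
    proof -
      have "c d n i * (h i (Suc n) - h (Suc i) (Suc n)) = (c d n i - 1) * \<delta> n i"
        using step[OF that, of n] by (simp add: \<delta>_def right_diff_distrib left_diff_distrib)
      also have "\<dots> = c d n i * ((1 - 1 / c d n i) * \<delta> n i)"
        using c2[of n i] by (simp add: right_diff_distrib left_diff_distrib)
      finally have "h i (Suc n) - h (Suc i) (Suc n) = (1 - 1 / c d n i) * \<delta> n i"
        using c2[of n i] by simp
      moreover have "\<bar>(1 - 1 / c d n i) * \<delta> n i\<bar> \<le> 1 * \<bar>\<delta> n i\<bar>"
        unfolding abs_mult using c2[of n i] by (intro mult_right_mono) auto
      ultimately show ?thesis using \<delta>[OF that] by linarith
    qed
    have chain: "\<bar>h (d - j) (Suc n) - h d (Suc n)\<bar> \<le> real j * e" if "j \<le> d" for j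
      using that
    proof (induction j)
      case (Suc j)
      then have "\<bar>h (d - Suc j) (Suc n) - h (d - j) (Suc n)\<bar> \<le> e"
        using diff[of "d - Suc j"] by (simp add: Suc_diff_Suc)
      then show ?case using Suc by (simp add: algebra_simps)
    qed simp
    have near: "\<bar>h i (Suc n) - h d (Suc n)\<bar> \<le> real d * e" if "i \<le> d" for i
    proof -
      have "\<bar>h (d - (d - i)) (Suc n) - h d (Suc n)\<bar> \<le> real (d - i) * e"
        by (rule chain) simp
      also have "\<dots> \<le> real d * e" using e by (intro mult_right_mono) auto
      finally show ?thesis using that by simp
    qed
    \<comment> \<open>The conserved total 1 pins the common value to \<open>1 / d\<close>.\<close>
    have "\<bar>1 - real d * h d (Suc n)\<bar> = \<bar>\<Sum>i<d. (h (Suc i) (Suc n) - h d (Suc n))\<bar>"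
      by (simp add: sum_subtractf total)
    also have "\<dots> \<le> (\<Sum>i<d. real d * e)"
      using near by (intro order_trans[OF sum_abs] sum_mono) auto
    finally have "\<bar>1 - real d * h d (Suc n)\<bar> \<le> real d * (real d * e)" by simp
    moreover have "1 - real d * h d (Suc n) = real d * (1 / real d - h d (Suc n))"
      using d by (simp add: right_diff_distrib)
    ultimately have "real d * \<bar>h d (Suc n) - 1 / real d\<bar> \<le> real d * (real d * e)"
      by (simp add: abs_mult abs_minus_commute)
    then have "\<bar>h d (Suc n) - 1 / real d\<bar> \<le> real d * e" using d by simp
    \<comment> \<open>Two distances of at most \<open>d * e\<close>, via \<open>h d (Suc n)\<close>;
      squaring and adding \<open>d\<close> such terms gives
      \<open>4 * d ^ 3 * e\<^sup>2\<close>.\<close>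
    then have "\<bar>h (Suc i) (Suc n) - 1 / real d\<bar> \<le> 2 * real d * e" if "i < d" for i
      using near[of "Suc i"] that by linarith
    then have "(h (Suc i) (Suc n) - 1 / real d)\<^sup>2 \<le> (2 * real d * e)\<^sup>2" if "i < d" for i
      using that e by (simp add: abs_le_square_iff[symmetric])
    then have "F (Suc n) \<le> (\<Sum>i<d. (2 * real d * e)\<^sup>2)"
      unfolding F_def by (intro sum_mono) auto
    then show ?thesis
      by (intro exI[of _ "Suc n"]) (simp add: power2_eq_square power3_eq_cube algebra_simps)
  qed
  have "F \<longlonglongrightarrow> 0"
  proof (rule LIMSEQ_I)
    fix r :: real assume r: "r > 0"
    define e where "e = sqrt (r / (8 * real d ^ 3))"
    have e: "e > 0" "4 * real d ^ 3 * e\<^sup>2 = r / 2" using r d by (auto simp: e_def)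
    obtain n where "F n \<le> r / 2" using F_small[OF e(1)] unfolding e(2) by blast
    then have "norm (F m - 0) < r" if "m \<ge> n" for m
      using decseqD[OF decF that] F0[of m] r by simp
    then show "\<exists>no. \<forall>m\<ge>no. norm (F m - 0) < r" by blast
  qed
  then have "(\<lambda>n. sqrt (F n)) \<longlonglongrightarrow> 0"
    using tendsto_real_sqrt by fastforce
  then have "(\<lambda>n. h d n - 1 / real d) \<longlonglongrightarrow> 0"
  proof (rule Lim_null_comparison[rotated], intro eventuallyI)
    fix n
    have "(h (Suc (d - 1)) n - 1 / real d)\<^sup>2 \<le> F n"
      unfolding F_def using d by (intro member_le_sum) auto
    then show "norm (h d n - 1 / real d) \<le> sqrt (F n)"
      using d by (simp add: real_le_rsqrt)
  qed
  then show ?thesis by (simp add: LIM_zero_iff)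
qed

section \<open>Weighted binomial differences and their cyclic recurrence\<close>

text \<open>These are the \<open>u_i(n)\<close> of the opening comment. The base
  \<open>k + 2\<close> comes from \<open>g d (k + 1) = 1 / (k + 2) ^ d\<close>.\<close>

definition weighted_difference :: "nat \<Rightarrow> nat \<Rightarrow> nat \<Rightarrow> real" where
  "weighted_difference d i n =
     (\<Sum>k=0..n. real (n choose k) * (- 1) ^ k * (\<Prod>j<k. 1 - g d (real j + 1)) / (real k + 2) ^ i)"

text \<open>Split \<open>n + 3 = (n + 1 - k) + (k + 2)\<close>. The first summand is absorbed by the
  binomial coefficient, which lowers its upper index; the second cancels one power in the
  denominator.\<close>

lemma weighted_difference_Suc:
  "(real n + 3) * weighted_difference d (Suc i) (Suc n) =
     (real n + 1) * weighted_difference d (Suc i) n + weighted_difference d i (Suc n)"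
proof -
  define a where "a k = (- 1) ^ k * (\<Prod>j<k. 1 - g d (real j + 1))" for k
  define w where "w i n k = real (n choose k) * a k / (real k + 2) ^ i" for i n k
  have eq: "weighted_difference d i n = (\<Sum>k=0..n. w i n k)" for i n
    by (simp add: weighted_difference_def a_def w_def mult.assoc)
  have binom: "(real n + 3) * real (Suc n choose k) =
      (real n + 1) * real (n choose k) + (real k + 2) * real (Suc n choose k)" if "k \<le> Suc n" for k
  proof -
    have "(Suc n - k) * (Suc n choose k) = Suc n * (n choose k)"
      using binomial_absorb_comp[of "Suc n" k] by simp
    then have "real (Suc n - k) * real (Suc n choose k) = real (Suc n) * real (n choose k)"
      by (metis of_nat_mult)
    then show ?thesis using that by (simp add: of_nat_diff algebra_simps)
  qed
  have w_Suc: "(real n + 3) * w (Suc i) (Suc n) k = (real n + 1) * w (Suc i) n k + w i (Suc n) k"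
    if "k \<le> Suc n" for k
  proof -
    have "(A + (real k + 2) * B) * x / ((real k + 2) * P) = A * x / ((real k + 2) * P) + B * x / P"
      for A B x P :: real
    proof -
      have "(real k + 2) * B * x / ((real k + 2) * P) = B * x / P"
        by (simp add: mult.assoc)
      then show ?thesis by (simp add: distrib_right add_divide_distrib)
    qed
    from this[of "(real n + 1) * real (n choose k)" "real (Suc n choose k)" "a k"
        "(real k + 2) ^ i"]
    show ?thesis unfolding binom[OF that, symmetric] by (simp add: w_def mult.assoc)
  qed
  have "(real n + 3) * weighted_difference d (Suc i) (Suc n) =
      (\<Sum>k=0..Suc n. (real n + 1) * w (Suc i) n k + w i (Suc n) k)"
    unfolding eq sum_distrib_left by (intro sum.cong refl w_Suc) simp
  also have "\<dots> = (real n + 1) * (\<Sum>k=0..Suc n. w (Suc i) n k) + weighted_difference d i (Suc n)"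
    unfolding eq sum.distrib sum_distrib_left ..
  also have "(\<Sum>k=0..Suc n. w (Suc i) n k) = weighted_difference d (Suc i) n"
    by (simp add: eq w_def binomial_eq_0)
  finally show ?thesis .
qed

text \<open>Dividing the \<open>k\<close>-th product by \<open>(k + 2) ^ d\<close> gives its
  decrease to the next product, and by Pascal's rule a binomial difference of decreases is a
  difference of one order higher.\<close>

lemma weighted_difference_wrap: "weighted_difference d d n = weighted_difference d 0 (Suc n)"
proof -
  define b where "b k = (\<Prod>j<k. 1 - g d (real j + 1))" for k
  have "weighted_difference d 0 (Suc n) =
      b 0 + (\<Sum>k=0..n. real (Suc n choose Suc k) * (- 1) ^ Suc k * b (Suc k))"
    unfolding weighted_difference_def b_def[symmetric]
    by (simp only: sum.atLeast0_atMost_Suc_shift) simp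
  also have "\<dots> = b 0 + (\<Sum>k=0..n. real (n choose Suc k) * (- 1) ^ Suc k * b (Suc k))
      - (\<Sum>k=0..n. real (n choose k) * (- 1) ^ k * b (Suc k))"
  proof -
    have "(\<Sum>k=0..n. real (Suc n choose Suc k) * (- 1) ^ Suc k * b (Suc k)) =
      (\<Sum>k=0..n. real (n choose Suc k) * (- 1) ^ Suc k * b (Suc k)
        - real (n choose k) * (- 1) ^ k * b (Suc k))"
      by (intro sum.cong refl) (simp add: algebra_simps)
    then show ?thesis by (simp only: sum_subtractf add_diff_eq)
  qed
  also have "b 0 + (\<Sum>k=0..n. real (n choose Suc k) * (- 1) ^ Suc k * b (Suc k)) =
      (\<Sum>k=0..Suc n. real (n choose k) * (- 1) ^ k * b k)"
    by (simp only: sum.atLeast0_atMost_Suc_shift) simp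
  also have "\<dots> = (\<Sum>k=0..n. real (n choose k) * (- 1) ^ k * b k)"
    by (simp add: binomial_eq_0)
  also have "\<dots> - (\<Sum>k=0..n. real (n choose k) * (- 1) ^ k * b (Suc k)) =
      weighted_difference d d n"
    by (simp add: weighted_difference_def b_def g_def sum_subtractf[symmetric] algebra_simps)
  finally show ?thesis ..
qed

lemma alternating_sum_tendsto:
  assumes d: "d \<ge> 1"
  shows "(\<lambda>n. (real n + 2) * weighted_difference d 0 (Suc n)) \<longlonglongrightarrow> 1 / real d"
proof -
  \<comment> \<open>The factor \<open>n + 1\<close> turns the recurrence into a convex combination.
    Index \<open>d\<close> gets \<open>n + 2\<close> because wrapping around advances the time by
    one.\<close>
  define h where
    "h i n = (if i = d then real n + 2 else real n + 1) * weighted_difference d i n" for i n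
  have "h d \<longlonglongrightarrow> 1 / real d"
  proof (rule cyclic_averaging_tendsto[OF d])
    show "h 0 (Suc n) = h d n" for n
      using d by (simp add: h_def weighted_difference_wrap algebra_simps)
    show "(if Suc i = d then real n + 2 else real n + 2 + 1) * h (Suc i) (Suc n) =
      ((if Suc i = d then real n + 2 else real n + 2 + 1) - 1) * h (Suc i) n + h i (Suc n)"
      if "i < d" for i n
    proof -
      define w w' v where "w = weighted_difference d (Suc i) (Suc n)"
        and "w' = weighted_difference d (Suc i) n" and "v = weighted_difference d i (Suc n)"
      have "(real n + 3) * w = (real n + 1) * w' + v"
        unfolding w_def w'_def v_def by (rule weighted_difference_Suc)
      then have v: "v = (real n + 3) * w - (real n + 1) * w'" by simp
      show ?thesis using that
        by (simp add: h_def v algebra_simps flip: w_def w'_def v_def)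
    qed
    obtain e where e: "d = Suc e" using d by (cases d) auto
    \<comment> \<open>At time 0 the values are the powers of \<open>1 / 2\<close>, with the last one
      doubled, hence their sum is 1.\<close>
    have geometric: "(\<Sum>i<m. (1 / 2) ^ Suc i) = 1 - (1 / 2 :: real) ^ m" for m
      by (induction m) auto
    have h0: "h (Suc i) 0 = (if Suc i = d then 2 else 1) * (1 / 2) ^ Suc i" for i
      by (simp add: h_def weighted_difference_def power_one_over)
    have "(\<Sum>i<d. h (Suc i) 0) = (\<Sum>i<e. (1 / 2) ^ Suc i) + (1 / 2) ^ e"
      by (simp add: e h0)
    then show "(\<Sum>i<d. h (Suc i) 0) = 1" unfolding geometric by simp
  qed
  moreover have "h d = (\<lambda>n. (real n + 2) * weighted_difference d 0 (Suc n))"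
    by (simp add: fun_eq_iff h_def weighted_difference_wrap)
  ultimately show ?thesis by simp
qed

section \<open>Moments of the volume below the current record\<close>

abbreviation unit_cube_measure :: "(real ^ 'd) measure" where
  "unit_cube_measure \<equiv> uniform_measure lborel (cbox 0 1)"

text \<open>On the cube this is the Lebesgue measure of \<open>cbox 0 r\<close>. The value 0
  elsewhere bounds it everywhere, not just almost surely, as \<open>expectation_indep_var\<close>
  requires.\<close>

definition box_volume :: "real ^ 'd \<Rightarrow> real" where
  "box_volume r = (if r \<in> cbox 0 1 then \<Prod>b\<in>Basis. r \<bullet> b else 0)"

lemma one_inner_Basis: "b \<in> Basis \<Longrightarrow> (1 :: real ^ 'd) \<bullet> b = 1"
  by (auto simp: Basis_vec_def inner_axis)

lemma box_volume_nonneg: "0 \<le> box_volume r"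
  by (auto simp: box_volume_def mem_box intro!: prod_nonneg)

lemma box_volume_le_1: "box_volume r \<le> 1"
  by (auto simp: box_volume_def mem_box one_inner_Basis intro!: prod_le_1)

lemma box_volume_power_bound: "\<bar>box_volume r ^ s\<bar> \<le> 1"
  by (simp add: power_abs power_le_one box_volume_nonneg box_volume_le_1)

lemma box_volume_measurable [measurable]: "box_volume \<in> borel_measurable borel"
  unfolding box_volume_def by measurable

lemma prec_iff: "prec x r \<longleftrightarrow> x \<noteq> r \<and> (\<forall>b\<in>Basis. x \<bullet> b \<le> r \<bullet> b)"
  by (auto simp: prec_def Basis_vec_def inner_axis)

lemma pred_prec [measurable (raw)]:
  assumes [measurable]: "f \<in> borel_measurable N" "h \<in> borel_measurable N"
  shows "Measurable.pred N (\<lambda>x. prec (f x) (h x))"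
  unfolding prec_iff by measurable

lemma prec_iff_cbox: "x \<in> cbox 0 1 \<Longrightarrow> prec x r \<longleftrightarrow> x \<noteq> r \<and> x \<in> cbox 0 r"
  by (auto simp: prec_iff mem_box)

lemma cbox_0_subset: "r \<in> cbox 0 1 \<Longrightarrow> cbox 0 r \<subseteq> cbox 0 (1 :: real ^ 'd)"
  by (auto simp: mem_box) (meson order_trans)

text \<open>The integrand is a product over the coordinates, so the integral factors into those of
  \<open>x ^ s\<close> over \<open>{0..r \<bullet> b}\<close>.\<close>

lemma nn_integral_box_volume:
  fixes r :: "real ^ 'd"
  assumes r: "r \<in> cbox 0 1"
  shows "(\<integral>\<^sup>+x. ennreal (box_volume x ^ s * indicator (cbox 0 r) x) \<partial>lborel) =
    ennreal (box_volume r ^ Suc s / (real s + 1) ^ CARD('d))"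
proof -
  have r0: "0 \<le> r \<bullet> b" if "b \<in> Basis" for b using r that by (simp add: mem_box)
  define f where "f b x = ennreal (x ^ s) * indicator {0..r \<bullet> b} x" for b and x :: real
  have f_measurable: "f b \<in> borel_measurable borel" for b unfolding f_def by measurable
  have "ennreal (box_volume x ^ s * indicator (cbox 0 r) x) = (\<Prod>b\<in>Basis. f b (x \<bullet> b))" for x
  proof (cases "x \<in> cbox 0 r")
    case True
    then have x: "0 \<le> x \<bullet> b" "x \<bullet> b \<le> r \<bullet> b" if "b \<in> Basis" for b
      using that by (simp_all add: mem_box)
    have "(\<Prod>b\<in>Basis. f b (x \<bullet> b)) = (\<Prod>b\<in>Basis. ennreal ((x \<bullet> b) ^ s))"
      by (intro prod.cong refl) (simp add: f_def x)
    also have "\<dots> = ennreal (\<Prod>b\<in>Basis. (x \<bullet> b) ^ s)" by (intro prod_ennreal) (simp add: x)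
    finally show ?thesis using True cbox_0_subset[OF r]
      by (auto simp: box_volume_def prod_power_distrib)
  next
    case False
    then obtain b where b: "b \<in> Basis" "x \<bullet> b \<notin> {0..r \<bullet> b}" by (auto simp: mem_box)
    then have "f b (x \<bullet> b) = 0" by (simp add: f_def)
    then have "(\<Prod>b\<in>Basis. f b (x \<bullet> b)) = 0" using b(1) by (intro prod_zero) auto
    then show ?thesis using False by simp
  qed
  then have "(\<integral>\<^sup>+x. ennreal (box_volume x ^ s * indicator (cbox 0 r) x) \<partial>lborel) =
      (\<Prod>b\<in>Basis. \<integral>\<^sup>+x. f b x \<partial>lborel)"
    by (simp add: nn_integral_lborel_prod f_measurable)
  also have "\<dots> = (\<Prod>b\<in>Basis. ennreal ((r \<bullet> b) ^ Suc s / (real s + 1)))"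
  proof (intro prod.cong refl)
    fix b :: "real ^ 'd" assume b: "b \<in> Basis"
    have "(\<integral>\<^sup>+x. ennreal (x ^ s) * indicator {0..r \<bullet> b} x \<partial>lborel) =
        ennreal ((r \<bullet> b) ^ Suc s / (real s + 1) - 0 ^ Suc s / (real s + 1))"
    proof (rule nn_integral_FTC_Icc)
      fix x :: real
      have "((\<lambda>x. x ^ Suc s) has_field_derivative (1 + real s) * x ^ s) (at x)"
        using DERIV_power_Suc[OF DERIV_ident, where n = s] by simp
      from DERIV_cdivide[OF this, of "real s + 1"]
      show "((\<lambda>x. x ^ Suc s / (real s + 1)) has_field_derivative x ^ s) (at x)"
        by (simp add: add.commute del: power_Suc)
    qed (use r0[OF b] in auto)
    then show "(\<integral>\<^sup>+x. f b x \<partial>lborel) = ennreal ((r \<bullet> b) ^ Suc s / (real s + 1))"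
      by (simp add: f_def)
  qed
  also have "\<dots> = ennreal (\<Prod>b\<in>Basis. (r \<bullet> b) ^ Suc s / (real s + 1))"
    by (intro prod_ennreal divide_nonneg_nonneg zero_le_power r0) auto
  also have "(\<Prod>b\<in>Basis. (r \<bullet> b) ^ Suc s / (real s + 1)) =
      box_volume r ^ Suc s / (real s + 1) ^ CARD('d)"
    using r by (simp add: box_volume_def prod_dividef prod_power_distrib del: power_Suc)
  finally show ?thesis .
qed

lemma emeasure_unit_cube: "emeasure lborel (cbox 0 (1 :: real ^ 'd)) = 1"
  by (simp add: emeasure_lborel_cbox_eq one_inner_Basis)

lemma prob_space_unit_cube: "prob_space (unit_cube_measure :: (real ^ 'd) measure)"
  by (rule prob_space_uniform_measure) (simp_all add: emeasure_unit_cube)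

lemma AE_unit_cube: "AE x in unit_cube_measure. x \<in> cbox 0 (1 :: real ^ 'd)"
  by (rule AE_uniform_measureI) auto

text \<open>One factor \<open>box_volume r\<close> is the probability of hitting the box. Given a
  hit, the volume is \<open>box_volume r\<close> times that of a uniform point of the cube, whose
  \<open>s\<close>-th moment is \<open>g CARD('d) s\<close>.\<close>

lemma integral_unit_cube_box_volume:
  fixes r :: "real ^ 'd"
  assumes r: "r \<in> cbox 0 1"
  shows "(\<integral>x. box_volume x ^ s * indicator (cbox 0 r) x \<partial>unit_cube_measure) =
    g CARD('d) (real s) * box_volume r ^ Suc s"
proof -
  have "(\<integral>\<^sup>+x. ennreal (box_volume x ^ s * indicator (cbox 0 r) x) \<partial>unit_cube_measure) =
      (\<integral>\<^sup>+x. ennreal (box_volume x ^ s * indicator (cbox 0 r) x) * indicator (cbox 0 1) x \<partial>lborel)"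
    by (subst nn_integral_uniform_measure) (simp_all add: emeasure_unit_cube divide_ennreal_def)
  also have "\<dots> = (\<integral>\<^sup>+x. ennreal (box_volume x ^ s * indicator (cbox 0 r) x) \<partial>lborel)"
    using cbox_0_subset[OF r] by (intro nn_integral_cong) (auto split: split_indicator)
  also have "\<dots> = ennreal (g CARD('d) (real s) * box_volume r ^ Suc s)"
    by (simp add: nn_integral_box_volume[OF r] g_def del: power_Suc)
  finally have "(\<integral>\<^sup>+x. ennreal (box_volume x ^ s * indicator (cbox 0 r) x) \<partial>unit_cube_measure) =
      ennreal (g CARD('d) (real s) * box_volume r ^ Suc s)" .
  then show ?thesis
    by (subst integral_eq_nn_integral)
      (auto simp: box_volume_nonneg g_def simp del: power_Suc)
qed

lemma AE_prec_iff_cbox: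
  "AE x in unit_cube_measure. prec x r \<longleftrightarrow> x \<in> cbox 0 (r :: real ^ 'd)"
proof -
  have "AE x in unit_cube_measure. x \<noteq> r"
    using AE_lborel_singleton[of r] by (intro AE_uniform_measureI) auto
  with AE_unit_cube show ?thesis by eventually_elim (simp add: prec_iff_cbox)
qed

lemma integral_unit_cube_prec:
  fixes r :: "real ^ 'd"
  assumes r: "r \<in> cbox 0 1"
  shows "(\<integral>x. (if prec x r then 1 else 0 :: real) \<partial>unit_cube_measure) = box_volume r"
proof -
  have "(\<integral>x. (if prec x r then 1 else 0 :: real) \<partial>unit_cube_measure) =
      (\<integral>x. box_volume x ^ 0 * indicator (cbox 0 r) x \<partial>unit_cube_measure)"
    using AE_prec_iff_cbox[of r]
    by (intro integral_cong_AE) (auto elim!: eventually_mono split: split_indicator)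
  then show ?thesis unfolding integral_unit_cube_box_volume[OF r] by (simp add: g_def)
qed

lemma integral_unit_cube_step:
  fixes r :: "real ^ 'd"
  assumes r: "r \<in> cbox 0 1"
  shows "(\<integral>x. box_volume (if prec x r then x else r) ^ s \<partial>unit_cube_measure) =
    box_volume r ^ s - (1 - g CARD('d) (real s)) * box_volume r ^ Suc s"
proof -
  interpret prob_space "unit_cube_measure :: (real ^ 'd) measure" by (rule prob_space_unit_cube)
  let ?I = "indicator (cbox 0 r) :: real ^ 'd \<Rightarrow> real"
  have int: "integrable unit_cube_measure (\<lambda>x. box_volume x ^ k * ?I x)" for k
    by (rule integrable_const_bound[where B = 1], rule AE_I2)
      (auto simp: box_volume_power_bound split: split_indicator)
  \<comment> \<open>Splits into hit and miss. The factor \<open>box_volume x ^ 0\<close> lets the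
    moment formula at exponent 0 supply the hit probability.\<close>
  have "(\<integral>x. box_volume (if prec x r then x else r) ^ s \<partial>unit_cube_measure) =
      (\<integral>x. box_volume x ^ s * ?I x + (box_volume r ^ s - box_volume r ^ s * (box_volume x ^ 0 * ?I x))
        \<partial>unit_cube_measure)"
    using AE_prec_iff_cbox[of r]
    by (intro integral_cong_AE) (auto elim!: eventually_mono split: split_indicator)
  also have "\<dots> = g CARD('d) (real s) * box_volume r ^ Suc s
      + (box_volume r ^ s - box_volume r ^ s * (g CARD('d) (real 0) * box_volume r ^ Suc 0))"
    using int[of s] int[of 0] integral_unit_cube_box_volume[OF r, of 0] prob_space
    by (simp add: integral_unit_cube_box_volume[OF r] del: power_Suc power_0)
  also have "\<dots> = box_volume r ^ s - (1 - g CARD('d) (real s)) * box_volume r ^ Suc s"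
    by (simp add: g_def algebra_simps)
  finally show ?thesis .
qed

section \<open>Integrating out an independent point\<close>

text \<open>Independence makes the joint law a product measure, and boundedness gives the
  integrability for Fubini.\<close>

lemma (in prob_space) expectation_indep_var:
  fixes \<phi> :: "'b \<Rightarrow> 'b \<Rightarrow> real"
  assumes ind: "indep_var N R K Y"
    and [measurable]: "(\<lambda>(r, y). \<phi> r y) \<in> borel_measurable (N \<Otimes>\<^sub>M K)"
    and bounded: "\<And>r y. \<bar>\<phi> r y\<bar> \<le> B"
  shows "expectation (\<lambda>\<omega>. \<phi> (R \<omega>) (Y \<omega>)) =
    expectation (\<lambda>\<omega>. \<integral>y. \<phi> (R \<omega>) y \<partial>distr M K Y)"
proof -
  have [measurable]: "random_variable N R" "random_variable K Y"
    using ind indep_var_rv1 indep_var_rv2 by blast+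
  interpret R: prob_space "distr M N R" by (rule prob_space_distr) measurable
  interpret Y: prob_space "distr M K Y" by (rule prob_space_distr) measurable
  interpret RY: pair_prob_space "distr M N R" "distr M K Y" ..
  have "expectation (\<lambda>\<omega>. \<phi> (R \<omega>) (Y \<omega>)) =
      (\<integral>p. (case p of (r, y) \<Rightarrow> \<phi> r y) \<partial>distr M (N \<Otimes>\<^sub>M K) (\<lambda>\<omega>. (R \<omega>, Y \<omega>)))"
    by (subst integral_distr) auto
  also have "\<dots> = (\<integral>p. (case p of (r, y) \<Rightarrow> \<phi> r y) \<partial>(distr M N R \<Otimes>\<^sub>M distr M K Y))"
    using ind by (simp add: indep_var_distribution_eq)
  also have "\<dots> = (\<integral>r. \<integral>y. \<phi> r y \<partial>distr M K Y \<partial>distr M N R)"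
    by (subst RY.integral_fst'[symmetric])
      (auto intro!: RY.integrable_const_bound[where B = B] simp: bounded split: prod.split)
  also have "\<dots> = expectation (\<lambda>\<omega>. \<integral>y. \<phi> (R \<omega>) y \<partial>distr M K Y)"
    by (subst integral_distr) auto
  finally show ?thesis .
qed

text \<open>Allows the sample to be restricted to the indices \<open>{1..Suc n}\<close> in
  \<open>indep_R_X\<close>.\<close>

lemma current_record_cong:
  "(\<And>i. 1 \<le> i \<Longrightarrow> i \<le> Suc n \<Longrightarrow> x i = y i) \<Longrightarrow> current_record x n = current_record y n"
  by (induction n) auto

lemma current_record_measurable:
  "{1..Suc n} \<subseteq> I \<Longrightarrow>
    (\<lambda>x :: nat \<Rightarrow> real ^ 'd. current_record x n) \<in> PiM I (\<lambda>_. borel) \<rightarrow>\<^sub>M borel"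
proof (induction n)
  case (Suc n)
  have "{1..Suc n} \<subseteq> I" using Suc.prems by auto
  note [measurable] = Suc.IH[OF this]
  have [measurable]: "(\<lambda>x :: nat \<Rightarrow> real ^ 'd. x (Suc (Suc n))) \<in> PiM I (\<lambda>_. borel) \<rightarrow>\<^sub>M borel"
    using Suc.prems by (intro measurable_component_singleton) auto
  show ?case by simp
qed (auto intro!: measurable_component_singleton)

section \<open>The moment recursion and its solution\<close>

text \<open>The first index counts the points seen. Before any point the record may be taken to be
  the corner \<open>1\<close>, with volume 1 below it.\<close>

primrec moment :: "nat \<Rightarrow> nat \<Rightarrow> nat \<Rightarrow> real" where
  "moment d 0 s = 1"
| "moment d (Suc n) s = moment d n s - (1 - g d (real s)) * moment d n (Suc s)"

text \<open>Pascal's rule, together with the first factor of the product splitting off: this raises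
  \<open>s\<close> by one, so the induction needs all \<open>s\<close> at once.\<close>

lemma moment_eq_sum:
  "moment d n s = (\<Sum>k=0..n. real (n choose k) * (- 1) ^ k * (\<Prod>j<k. 1 - g d (real s + real j)))"
proof (induction n arbitrary: s)
  case (Suc n)
  define b where "b s k = (\<Prod>j<k. 1 - g d (real s + real j))" for s k
  have b_Suc: "b s (Suc k) = (1 - g d (real s)) * b (Suc s) k" for k
    unfolding b_def by (subst prod.lessThan_Suc_shift) (simp add: add.commute add.left_commute)
  have "(\<Sum>k=0..Suc n. real (Suc n choose k) * (- 1) ^ k * b s k) =
      b s 0 + (\<Sum>k=0..n. real (Suc n choose Suc k) * (- 1) ^ Suc k * b s (Suc k))"
    by (simp only: sum.atLeast0_atMost_Suc_shift) simp
  also have "(\<Sum>k=0..n. real (Suc n choose Suc k) * (- 1) ^ Suc k * b s (Suc k)) =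
      (\<Sum>k=0..n. real (n choose Suc k) * (- 1) ^ Suc k * b s (Suc k)
        - (1 - g d (real s)) * (real (n choose k) * (- 1) ^ k * b (Suc s) k))"
    by (intro sum.cong refl) (simp add: b_Suc algebra_simps)
  also have "\<dots> = (\<Sum>k=0..n. real (n choose Suc k) * (- 1) ^ Suc k * b s (Suc k))
        - (1 - g d (real s)) * moment d n (Suc s)"
    by (simp only: sum_subtractf sum_distrib_left[symmetric] Suc.IH b_def)
  also have "b s 0 + \<dots> = (\<Sum>k=0..Suc n. real (n choose k) * (- 1) ^ k * b s k)
        - (1 - g d (real s)) * moment d n (Suc s)"
    by (simp only: sum.atLeast0_atMost_Suc_shift) simp
  also have "(\<Sum>k=0..Suc n. real (n choose k) * (- 1) ^ k * b s k) = moment d n s"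
    by (simp add: Suc.IH b_def binomial_eq_0)
  finally show ?case by (simp add: b_def)
qed simp

section \<open>Uniform samples and their record probabilities\<close>

locale uniform_sample = prob_space M for M :: "'a measure" +
  fixes X :: "nat \<Rightarrow> 'a \<Rightarrow> real ^ 'd"
  assumes indep: "indep_vars (\<lambda>_. borel) X {1..}"
    and distr_X: "\<And>n. n \<ge> 1 \<Longrightarrow> distr M borel (X n) = unit_cube_measure"
begin

abbreviation R :: "nat \<Rightarrow> 'a \<Rightarrow> real ^ 'd" where
  "R n \<omega> \<equiv> current_record (\<lambda>m. X m \<omega>) n"

lemma X_measurable: "n \<ge> 1 \<Longrightarrow> X n \<in> borel_measurable M"
  using indep by (auto simp: indep_vars_def)

lemma AE_X:
  assumes "n \<ge> 1"
  shows "AE \<omega> in M. X n \<omega> \<in> cbox 0 1"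
  by (rule AE_distrD[OF X_measurable[OF assms]]) (simp only: distr_X[OF assms] AE_unit_cube)

text \<open>The two variables are functions of the sample on the disjoint index sets
  \<open>{1..Suc n}\<close> and \<open>{Suc (Suc n)}\<close>.\<close>

lemma indep_R_X: "indep_var borel (R n) borel (X (Suc (Suc n)))"
proof -
  have "indep_var borel ((\<lambda>x. current_record x n) \<circ> (\<lambda>\<omega>. restrict (\<lambda>i. X i \<omega>) {1..Suc n}))
      borel ((\<lambda>x. x (Suc (Suc n))) \<circ> (\<lambda>\<omega>. restrict (\<lambda>i. X i \<omega>) {Suc (Suc n)}))"
    by (rule indep_var_compose[OF indep_var_restrict[OF indep]])
      (auto intro!: current_record_measurable)
  moreover have "(\<lambda>x. current_record x n) \<circ> (\<lambda>\<omega>. restrict (\<lambda>i. X i \<omega>) {1..Suc n}) = R n"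
    by (auto simp: fun_eq_iff intro!: current_record_cong)
  moreover have "(\<lambda>x. x (Suc (Suc n))) \<circ> (\<lambda>\<omega>. restrict (\<lambda>i. X i \<omega>) {Suc (Suc n)}) = X (Suc (Suc n))"
    by (auto simp: fun_eq_iff)
  ultimately show ?thesis by simp
qed

lemma R_measurable: "R n \<in> borel_measurable M"
  using indep_R_X by (rule indep_var_rv1)

lemma AE_R: "AE \<omega> in M. R n \<omega> \<in> cbox 0 1"
proof (induction n)
  case (Suc n)
  have "AE \<omega> in M. X (Suc (Suc n)) \<omega> \<in> cbox 0 1" by (rule AE_X) simp
  with Suc show ?case by eventually_elim auto
qed (simp add: AE_X)

lemma expectation_box_volume:
  "expectation (\<lambda>\<omega>. box_volume (R n \<omega>) ^ s) = moment CARD('d) (Suc n) s"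
proof (induction n arbitrary: s)
  case 0
  have one: "(1 :: real ^ 'd) \<in> cbox 0 1" by (simp add: mem_box one_inner_Basis)
  have "expectation (\<lambda>\<omega>. box_volume (R 0 \<omega>) ^ s) = (\<integral>x. box_volume x ^ s \<partial>distr M borel (X 1))"
    by (subst integral_distr) (auto simp: X_measurable)
  \<comment> \<open>The first point is treated as a hit of the box below the corner
    \<open>1\<close>.\<close>
  also have "\<dots> = (\<integral>x. box_volume x ^ s * indicator (cbox 0 (1 :: real ^ 'd)) x \<partial>unit_cube_measure)"
    using AE_unit_cube unfolding distr_X[OF order_refl]
    by (intro integral_cong_AE) (auto elim!: eventually_mono)
  also have "\<dots> = g CARD('d) (real s)"
    unfolding integral_unit_cube_box_volume[OF one]
    using one by (simp add: box_volume_def one_inner_Basis)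
  finally show ?case by simp
next
  case (Suc n)
  have int: "integrable M (\<lambda>\<omega>. box_volume (R n \<omega>) ^ k)" for k
    using R_measurable[of n]
    by (intro integrable_const_bound[where B = 1])
      (auto simp: box_volume_power_bound)
  have [measurable]: "R n \<in> borel_measurable M" by (rule R_measurable)
  \<comment> \<open>Sigma-finiteness is what makes the inner integral measurable.\<close>
  interpret U: prob_space "unit_cube_measure :: (real ^ 'd) measure" by (rule prob_space_unit_cube)
  have "expectation (\<lambda>\<omega>. box_volume (R (Suc n) \<omega>) ^ s) =
      expectation (\<lambda>\<omega>. (\<lambda>r x. box_volume (if prec x r then x else r) ^ s) (R n \<omega>) (X (Suc (Suc n)) \<omega>))"
    by simp
  also have "\<dots> = expectation (\<lambda>\<omega>. \<integral>x. box_volume (if prec x (R n \<omega>) then x else R n \<omega>) ^ s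
      \<partial>distr M borel (X (Suc (Suc n))))"
    by (rule expectation_indep_var[OF indep_R_X, where B = 1])
      (measurable, rule box_volume_power_bound)
  also have "\<dots> = expectation (\<lambda>\<omega>. box_volume (R n \<omega>) ^ s
      - (1 - g CARD('d) (real s)) * box_volume (R n \<omega>) ^ Suc s)"
    using AE_R[of n]
    by (intro integral_cong_AE) (auto simp: distr_X integral_unit_cube_step elim!: eventually_mono)
  also have "\<dots> = moment CARD('d) (Suc (Suc n)) s"
    using int[of s] int[of "Suc s"] by (simp add: Suc.IH del: power_Suc moment.simps) simp
  finally show ?case .
qed

text \<open>Given \<open>R m\<close>, the next point is a record with probability the volume below
  \<open>R m\<close>, whence the first moment. For \<open>n = 0\<close> both sides are 1.\<close>

lemma chain_record_prob_Suc: "chain_record_prob M X (Suc n) = moment CARD('d) n 1"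
proof (cases n)
  case 0
  then show ?thesis
    using prob_space by (simp add: chain_record_prob_def chain_record_at_1[simplified])
next
  case (Suc m)
  have [measurable]: "R m \<in> borel_measurable M" "X (Suc (Suc m)) \<in> borel_measurable M"
    by (simp_all add: R_measurable X_measurable)
  \<comment> \<open>Sigma-finiteness is what makes the inner integral measurable.\<close>
  interpret U: prob_space "unit_cube_measure :: (real ^ 'd) measure" by (rule prob_space_unit_cube)
  have "chain_record_prob M X (Suc n) = prob {\<omega> \<in> space M. prec (X (Suc (Suc m)) \<omega>) (R m \<omega>)}"
    by (simp only: chain_record_prob_def Suc chain_record_at_iff)
  also have "\<dots> = expectation (indicator {\<omega> \<in> space M. prec (X (Suc (Suc m)) \<omega>) (R m \<omega>)})"
    by simp
  also have "\<dots> = expectation (\<lambda>\<omega>. (\<lambda>r x. (if prec x r then 1 else 0 :: real)) (R m \<omega>) (X (Suc (Suc m)) \<omega>))"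
    by (intro Bochner_Integration.integral_cong refl) (auto split: split_indicator)
  also have "\<dots> = expectation (\<lambda>\<omega>. \<integral>x. (if prec x (R m \<omega>) then 1 else 0 :: real) \<partial>distr M borel (X (Suc (Suc m))))"
  proof (rule expectation_indep_var[OF indep_R_X, where B = 1])
    show "(\<lambda>(r, x :: real ^ 'd). if prec x r then 1 else 0 :: real)
        \<in> borel_measurable (borel \<Otimes>\<^sub>M borel)"
      by measurable
  qed simp
  also have "\<dots> = expectation (\<lambda>\<omega>. box_volume (R m \<omega>) ^ 1)"
    using AE_R[of m]
    by (intro integral_cong_AE) (auto simp: distr_X integral_unit_cube_prec elim!: eventually_mono)
  also have "\<dots> = moment CARD('d) n 1"
    unfolding Suc by (rule expectation_box_volume)
  finally show ?thesis .
qed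

end

theorem mainTheorem2:
  fixes M :: "'a measure" and X :: "nat \<Rightarrow> 'a \<Rightarrow> real ^ 'd"
  assumes "prob_space M"
    and "prob_space.indep_vars M (\<lambda>_. borel) X {1..}"
    and "\<And>n. n \<ge> 1 \<Longrightarrow> distr M borel (X n) = uniform_measure lborel (cbox 0 1)"
  shows "(\<forall>n\<ge>1. chain_record_prob M X n =
            (\<Sum>k=0..n - 1. real ((n - 1) choose k) * (- 1) ^ k *
               (\<Prod>j<k. 1 - g CARD('d) (real j + 1))))
       \<and> chain_record_prob M X \<sim>[sequentially] (\<lambda>n. 1 / (real CARD('d) * real n))"
proof -
  interpret uniform_sample M X
    using assms by (simp add: uniform_sample_def uniform_sample_axioms_def)
  let ?p = "chain_record_prob M X" and ?d = "CARD('d)"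
  have sum_eq: "?p (Suc n) = (\<Sum>k=0..n. real (n choose k) * (- 1) ^ k *
      (\<Prod>j<k. 1 - g ?d (real j + 1)))" for n
    by (simp add: chain_record_prob_Suc moment_eq_sum add.commute)
  then have p_eq: "?p (Suc n) = weighted_difference ?d 0 n" for n
    by (simp add: weighted_difference_def)
  have d: "?d \<ge> 1" by (simp add: Suc_leI)
  \<comment> \<open>The limit concerns order \<open>n + 1\<close>, which is the probability at index
    \<open>n + 2\<close>; the scale \<open>n + 2\<close> therefore matches the index.\<close>
  have "(\<lambda>n. real (n + 2) * ?p (n + 2)) \<longlonglongrightarrow> 1 / real ?d"
    using alternating_sum_tendsto[OF d] by (simp add: p_eq add.commute)
  then have "(\<lambda>n. real n * ?p n) \<longlonglongrightarrow> 1 / real ?d"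
    by (rule LIMSEQ_offset)
  then have "(\<lambda>n. real ?d * (real n * ?p n)) \<longlonglongrightarrow> real ?d * (1 / real ?d)"
    by (intro tendsto_intros)
  \<comment> \<open>At \<open>n = 0\<close> division by zero gives 0, as does the product, so the
    two sequences agree everywhere.\<close>
  then have "(\<lambda>n. ?p n / (1 / (real ?d * real n))) \<longlonglongrightarrow> 1"
    by (simp add: mult_ac)
  then have "?p \<sim>[sequentially] (\<lambda>n. 1 / (real ?d * real n))"
    by (rule asymp_equivI'_const[where c = 1, simplified])
  moreover have "\<forall>n\<ge>1. ?p n = (\<Sum>k=0..n - 1. real ((n - 1) choose k) * (- 1) ^ k *
      (\<Prod>j<k. 1 - g ?d (real j + 1)))"
    using sum_eq by (metis Suc_diff_1 Suc_le_eq One_nat_def)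
  ultimately show ?thesis by blast
qed

end
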